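(* Let $n\ge 2$ be an integer, $\lambda>\frac{1}{n-1}$, $\mu<0$, and let $f\in C^1([0,\infty))\cap C^2(0,\infty)$ be the unique solution of the initial value problem $$f_{rr}(r)+\frac{n-1}{r}\,(1+f_r(r)^2)\,f_r(r)-\frac{1}{\lambda}\cdot\frac{(1+f_r(r)^2)^2}{r f_r(r)-f(r)}=0\quad\text{for all } r>0,\qquad f(0)=\mu,\quad f_r(0)=0.$$ Then $$\lim_{r\to\infty}\frac{r f_r(r)}{f(r)}=\frac{\lambda(n-1)}{\lambda(n-1)-1}.$$
   Context: Here $f$ is a real-valued function of one real variable $r\ge 0$; $f_r$ and $f_{rr}$ denote its first and second derivatives, the derivative at $r=0$ being one-sided. Being a solution of the equation entails that the denominator $r f_r(r)-f(r)$ does not vanish (hence, being continuous and equal to $-\mu>0$ at $r=0$, it is positive). Existence and uniqueness of such a solution $f$ is a separate result of the paper. *)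

theory Defs
  imports "HOL-Analysis.Analysis"
begin

end

theory Submission
  imports Defs
begin

text \<open>
  Write \<open>p\<close> for the slope \<open>f_r\<close>, \<open>w = r p - f\<close> for the denominator, and put \<open>m = n - 1\<close>,
  \<open>c = \<lambda> m > 1\<close>. Since \<open>w\<close> is continuous, nonzero and equal to \<open>-\<mu> > 0\<close> at the origin, it is
  positive. The two competing terms of the equation balance exactly when
  \<open>(1 + p\<^sup>2) r = c w p\<close>, so their relative imbalance
  \<open>A = (1 + p\<^sup>2) r / (c w p) - 1\<close> is the natural second unknown. Because \<open>w' = r p'\<close>, the pair
  \<open>(p, A)\<close> solves the closed system

    \<^item> \<open>r p' = m (1 + p\<^sup>2) p A\<close>,
    \<^item> \<open>r A' = (1 + A) (1 - m A (1 + p\<^sup>2 (c - 1 + c A)))\<close>,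

  which is autonomous in the variable \<open>ln r\<close>.

  Both \<open>p\<close> and \<open>A\<close> stay positive: each can cross zero only upwards (\<open>stays_positive\<close>), so if one of
  them were nonpositive at some radius, it would be so all the way back to the origin; the sign of
  \<open>p'\<close> on that interval then contradicts \<open>p 0 = 0\<close>. Hence \<open>p\<close> increases. If \<open>p\<close> were bounded, the
  second equation would keep \<open>A\<close> away from zero, and then \<open>p\<close> would grow at least like \<open>ln r\<close>; so
  \<open>p\<close> tends to infinity. The damping term \<open>m A p\<^sup>2 (c - 1)\<close>, whose coefficient is positive because
  \<open>\<lambda> > 1 / (n - 1)\<close>, then becomes arbitrarily strong and forces \<open>A\<close> to zero
  (\<open>slope_system_limits\<close>). Consequently \<open>w / (r p) = (1 + 1 / p\<^sup>2) / (c (1 + A))\<close> tends to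
  \<open>1 / c\<close>, and \<open>r p / f = 1 / (1 - w / (r p))\<close> tends to \<open>c / (c - 1)\<close>.
\<close>

section \<open>Barriers for differentiable functions\<close>

text \<open>
  At the first zero after \<open>a\<close> a function that starts positive would have to arrive from above, which
  a positive derivative forbids. Differentiability is asked for only at zeros, and not at \<open>a\<close>, so
  that the lemma applies up to the singular point of a differential equation and, vacuously, to
  functions without zeros.
\<close>
lemma stays_positive:
  fixes g g' :: "real \<Rightarrow> real"
  assumes "a \<le> b" and cont: "continuous_on {a..b} g" and "g a > 0"
    and deriv: "\<And>x. a < x \<Longrightarrow> x \<le> b \<Longrightarrow> g x = 0 \<Longrightarrow>
                  (g has_real_derivative g' x) (at x) \<and> g' x > 0"
  shows "g b > 0"
proof (rule ccontr)
  assume "\<not> g b > 0"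
  define S where "S = {x \<in> {a..b}. g x \<le> 0}"
  have "S = {a..b} \<inter> g -` {..0}" by (auto simp: S_def)
  then have "compact S"
    unfolding compact_eq_bounded_closed
    using continuous_closed_preimage[OF cont closed_atLeastAtMost closed_atMost[of 0]]
    by (auto intro: bounded_subset[OF bounded_closed_interval])
  moreover have "S \<noteq> {}"
    using \<open>a \<le> b\<close> \<open>\<not> g b > 0\<close> by (auto simp: S_def)
  ultimately obtain x where x: "x \<in> S" and least: "\<And>y. y \<in> S \<Longrightarrow> x \<le> y"
    using compact_attains_inf by metis
  have "a < x" "x \<le> b" "g x \<le> 0"
    using x \<open>g a > 0\<close> by (auto simp: S_def order_less_le)
  have pos: "g y > 0" if "a \<le> y" "y < x" for y
    using least[of y] that \<open>x \<le> b\<close> by (force simp: S_def)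
  have "\<exists>y. a \<le> y \<and> y \<le> x \<and> g y = 0"
    using \<open>g a > 0\<close> \<open>g x \<le> 0\<close> \<open>a < x\<close> \<open>x \<le> b\<close>
    by (intro IVT2' continuous_on_subset[OF cont]) auto
  then have "g x = 0"
    using pos by (metis order_le_less less_irrefl)
  then have "(g has_real_derivative g' x) (at x)" "g' x > 0"
    using deriv \<open>a < x\<close> \<open>x \<le> b\<close> by auto
  then obtain d where "d > 0" and d: "\<And>h. 0 < h \<Longrightarrow> h < d \<Longrightarrow> g (x - h) < g x"
    using DERIV_pos_inc_left by blast
  define h where "h = min (d / 2) (x - a)"
  have "0 < h" "h < d" "h \<le> x - a"
    using \<open>d > 0\<close> \<open>a < x\<close> by (auto simp: h_def)
  then show False
    using d[of h] pos[of "x - h"] \<open>g x = 0\<close> by auto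
qed

section \<open>Asymptotics of the slope system\<close>

text \<open>
  Both limits come from barriers for \<open>A\<close>: a lower one, available as long as \<open>p\<close> is bounded, which
  makes \<open>p\<close> grow logarithmically; and, once \<open>p\<close> is large, an upper one at any height \<open>\<epsilon>\<close>. It
  is eventually passed, because above it \<open>A\<close> decreases at least as fast as \<open>- ln r\<close>.
\<close>
lemma slope_system_limits:
  fixes p A :: "real \<Rightarrow> real" and m c :: real
  assumes "m > 0" "c > 1"
    and p_pos: "\<And>r. r > 0 \<Longrightarrow> p r > 0" and A_pos: "\<And>r. r > 0 \<Longrightarrow> A r > 0"
    and p_deriv: "\<And>r. r > 0 \<Longrightarrow>
          (p has_real_derivative m * (1 + (p r)\<^sup>2) * p r * A r / r) (at r)"
    and A_deriv: "\<And>r. r > 0 \<Longrightarrow>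
          (A has_real_derivative
             (1 + A r) * (1 - m * A r * (1 + (p r)\<^sup>2 * (c - 1 + c * A r))) / r) (at r)"
  shows "filterlim p at_top at_top" and "(A \<longlongrightarrow> 0) at_top"
proof -
  have contA: "continuous_on {a..b} A" if "a > 0" for a b
    using that by (intro continuous_at_imp_continuous_on ballI DERIV_isCont[OF A_deriv]) auto
  have p_mono: "p a \<le> p b" if "0 < a" "a \<le> b" for a b
  proof (rule DERIV_nonneg_imp_nondecreasing[OF \<open>a \<le> b\<close>])
    fix x assume "a \<le> x" "x \<le> b"
    then have "x > 0" using that by simp
    moreover have "m * (1 + (p x)\<^sup>2) * p x * A x / x \<ge> 0"
      using \<open>x > 0\<close> \<open>m > 0\<close> p_pos[of x] A_pos[of x] by auto
    ultimately show "\<exists>y. (p has_real_derivative y) (at x) \<and> 0 \<le> y"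
      using p_deriv by blast
  qed
  have p_unbounded: "\<exists>r>0. p r > P" for P
  proof (rule ccontr)
    assume "\<not> ?thesis"
    then have P: "p r \<le> P" if "r > 0" for r
      using that by force
    have "P > 0"
      using P[of 1] p_pos[of 1] by simp
    \<comment> \<open>For \<open>p \<le> P\<close> and \<open>A \<le> 1\<close> the damping factor is at most \<open>K\<close>, so \<open>A\<close> increases at any
      level \<open>\<delta> \<le> 1\<close> with \<open>m \<delta> K < 1\<close> and cannot fall back to it.\<close>
    define K where "K = 1 + P\<^sup>2 * (c - 1 + c)"
    have "K > 1"
      using \<open>P > 0\<close> \<open>c > 1\<close> by (simp add: K_def)
    define \<delta> where "\<delta> = min (A 1 / 2) (min 1 (1 / (2 * m * K)))"
    have "\<delta> > 0" "\<delta> < A 1" "\<delta> \<le> 1" "\<delta> \<le> 1 / (2 * m * K)"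
      using A_pos[of 1] \<open>m > 0\<close> \<open>K > 1\<close> by (auto simp: \<delta>_def)
    then have small: "m * \<delta> * K < 1"
      using \<open>m > 0\<close> \<open>K > 1\<close> by (simp add: field_simps)
    have A_gt: "A r > \<delta>" if "r \<ge> 1" for r
    proof -
      have "A r - \<delta> > 0"
      proof (rule stays_positive[OF that])
        show "continuous_on {1..r} (\<lambda>r. A r - \<delta>)"
          by (intro continuous_intros contA) simp
        show "A 1 - \<delta> > 0" using \<open>\<delta> < A 1\<close> by simp
        fix x assume "1 < x" "x \<le> r" and "A x - \<delta> = 0"
        then have [simp]: "A x = \<delta>" by simp
        have "1 + (p x)\<^sup>2 * (c - 1 + c * \<delta>) \<le> K"
          unfolding K_def
          using P[of x] p_pos[of x] \<open>1 < x\<close> \<open>c > 1\<close> \<open>\<delta> > 0\<close> \<open>\<delta> \<le> 1\<close>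
          by (intro add_mono mult_mono power_mono) auto
        then have "m * \<delta> * (1 + (p x)\<^sup>2 * (c - 1 + c * \<delta>)) < 1"
          using small \<open>m > 0\<close> \<open>\<delta> > 0\<close>
          by (meson mult_left_mono mult_pos_pos order_le_less_trans less_imp_le)
        moreover have "((\<lambda>r. A r - \<delta>) has_real_derivative
             (1 + A x) * (1 - m * A x * (1 + (p x)\<^sup>2 * (c - 1 + c * A x))) / x) (at x)"
          using A_deriv[of x] \<open>1 < x\<close> by (auto intro!: derivative_eq_intros)
        ultimately show "((\<lambda>r. A r - \<delta>) has_real_derivative
             (1 + A x) * (1 - m * A x * (1 + (p x)\<^sup>2 * (c - 1 + c * A x))) / x) (at x) \<and>
             (1 + A x) * (1 - m * A x * (1 + (p x)\<^sup>2 * (c - 1 + c * A x))) / x > 0"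
          using \<open>1 < x\<close> \<open>\<delta> > 0\<close> by auto
      qed
      then show ?thesis by simp
    qed
    \<comment> \<open>Since \<open>A > \<delta>\<close> and \<open>p \<ge> p 1\<close>, the slope satisfies \<open>p' \<ge> \<kappa> / r\<close>.\<close>
    define \<kappa> where "\<kappa> = m * p 1 * \<delta>"
    have "\<kappa> > 0"
      using \<open>m > 0\<close> p_pos[of 1] \<open>\<delta> > 0\<close> by (simp add: \<kappa>_def)
    have growth: "p 1 - \<kappa> * ln 1 \<le> p r - \<kappa> * ln r" if "r \<ge> 1" for r
    proof (rule DERIV_nonneg_imp_nondecreasing[OF that])
      fix x assume "1 \<le> x" "x \<le> r"
      have "m * 1 * p 1 * \<delta> \<le> m * (1 + (p x)\<^sup>2) * p x * A x"
        using \<open>m > 0\<close> \<open>\<delta> > 0\<close> p_mono[of 1 x] p_pos[of 1] p_pos[of x] A_gt[of x] \<open>1 \<le> x\<close>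
        by (intro mult_mono) auto
      then have "m * (1 + (p x)\<^sup>2) * p x * A x / x - \<kappa> * (1 / x) \<ge> 0"
        using \<open>1 \<le> x\<close> by (simp add: \<kappa>_def divide_right_mono)
      moreover have "((\<lambda>r. p r - \<kappa> * ln r) has_real_derivative
          m * (1 + (p x)\<^sup>2) * p x * A x / x - \<kappa> * (1 / x)) (at x)"
        using \<open>1 \<le> x\<close> by (intro DERIV_diff DERIV_cmult p_deriv DERIV_ln_divide) auto
      ultimately show "\<exists>y. ((\<lambda>r. p r - \<kappa> * ln r) has_real_derivative y) (at x) \<and> 0 \<le> y"
        by blast
    qed
    define r where "r = exp (P / \<kappa>)"
    have "r \<ge> 1"
      using \<open>P > 0\<close> \<open>\<kappa> > 0\<close> by (simp add: r_def)
    then have "p 1 + P \<le> p r"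
      using growth[of r] \<open>\<kappa> > 0\<close> by (simp add: r_def)
    then show False
      using P[of r] p_pos[of 1] \<open>r \<ge> 1\<close> by simp
  qed
  show p_lim: "filterlim p at_top at_top"
    unfolding filterlim_at_top
  proof
    fix P
    obtain r where "r > 0" "p r > P" using p_unbounded by blast
    then show "\<forall>\<^sub>F x in at_top. P \<le> p x"
      using p_mono by (intro eventually_at_top_linorderI[of r]) force
  qed
  have A_small: "\<forall>\<^sub>F r in at_top. A r < \<epsilon>" if "\<epsilon> > 0" for \<epsilon>
  proof -
    \<comment> \<open>Beyond the slope \<open>P\<close> and above the level \<open>\<epsilon>\<close> the damping is at least \<open>2\<close>, twice the source
      term \<open>1\<close>.\<close>
    define D where "D = m * \<epsilon> * (c - 1)"
    define P where "P = 1 + 2 / D"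
    have "D > 0"
      using \<open>\<epsilon> > 0\<close> \<open>m > 0\<close> \<open>c > 1\<close> by (simp add: D_def)
    then have "P > 1" "D * P \<ge> 2"
      by (simp_all add: P_def distrib_left)
    obtain R where "R > 0" and R: "p R > P" using p_unbounded by blast
    have bound: "(1 + A r) * (1 - m * A r * (1 + (p r)\<^sup>2 * (c - 1 + c * A r))) / r \<le> - 1 / r"
      if "r \<ge> R" "A r \<ge> \<epsilon>" for r
    proof -
      have "p r \<ge> P" using p_mono[of R r] R \<open>R > 0\<close> that by simp
      have "P \<le> P\<^sup>2" using \<open>P > 1\<close> by (simp add: power2_eq_square)
      also have "\<dots> \<le> (p r)\<^sup>2" using \<open>p r \<ge> P\<close> \<open>P > 1\<close> by (intro power_mono) auto
      finally have "P * (c - 1) \<le> (p r)\<^sup>2 * (c - 1 + c * A r)"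
        using \<open>c > 1\<close> \<open>\<epsilon> > 0\<close> that by (intro mult_mono) auto
      then have "P * (c - 1) \<le> 1 + (p r)\<^sup>2 * (c - 1 + c * A r)"
        by linarith
      then have "m * \<epsilon> * (P * (c - 1)) \<le> m * A r * (1 + (p r)\<^sup>2 * (c - 1 + c * A r))"
        using \<open>m > 0\<close> \<open>\<epsilon> > 0\<close> \<open>c > 1\<close> \<open>P > 1\<close> that
        by (intro mult_mono) auto
      then have le: "1 - m * A r * (1 + (p r)\<^sup>2 * (c - 1 + c * A r)) \<le> - 1"
        using \<open>D * P \<ge> 2\<close> by (simp add: D_def mult_ac)
      have "(1 + A r) * (1 - m * A r * (1 + (p r)\<^sup>2 * (c - 1 + c * A r))) \<le> (1 + A r) * (- 1)"
        by (rule mult_left_mono[OF le]) (use that \<open>\<epsilon> > 0\<close> in auto)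
      also have "\<dots> \<le> - 1" using that \<open>\<epsilon> > 0\<close> by simp
      finally show ?thesis
        using that \<open>R > 0\<close> by (intro divide_right_mono) auto
    qed
    have "\<exists>r1\<ge>R. A r1 < \<epsilon>"
    proof (rule ccontr)
      assume "\<not> ?thesis"
      then have large: "A r \<ge> \<epsilon>" if "r \<ge> R" for r using that by force
      have decay: "A r + ln r \<le> A R + ln R" if "r \<ge> R" for r
      proof (rule DERIV_nonpos_imp_nonincreasing[OF that])
        fix x assume "R \<le> x" "x \<le> r"
        have "((\<lambda>r. A r + ln r) has_real_derivative
            (1 + A x) * (1 - m * A x * (1 + (p x)\<^sup>2 * (c - 1 + c * A x))) / x + 1 / x) (at x)"
          using \<open>R \<le> x\<close> \<open>R > 0\<close> by (intro DERIV_add A_deriv DERIV_ln_divide) auto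
        moreover have "(1 + A x) * (1 - m * A x * (1 + (p x)\<^sup>2 * (c - 1 + c * A x))) / x + 1 / x \<le> 0"
          using bound[OF \<open>R \<le> x\<close> large[OF \<open>R \<le> x\<close>]] by simp
        ultimately show "\<exists>y. ((\<lambda>r. A r + ln r) has_real_derivative y) (at x) \<and> y \<le> 0"
          by blast
      qed
      define r where "r = exp (A R + ln R)"
      have "r = exp (A R) * R"
        using \<open>R > 0\<close> by (simp add: r_def exp_add)
      then have "r \<ge> R"
        using A_pos[OF \<open>R > 0\<close>] \<open>R > 0\<close> by simp
      then have "A r \<le> 0"
        using decay[of r] by (simp add: r_def)
      then show False
        using A_pos[of r] \<open>r \<ge> R\<close> \<open>R > 0\<close> by simp
    qed
    then obtain r1 where "r1 \<ge> R" "A r1 < \<epsilon>" by blast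
    have "A r < \<epsilon>" if "r \<ge> r1" for r
    proof -
      have "\<epsilon> - A r > 0"
      proof (rule stays_positive[OF that])
        show "continuous_on {r1..r} (\<lambda>r. \<epsilon> - A r)"
          using \<open>r1 \<ge> R\<close> \<open>R > 0\<close> by (intro continuous_intros contA) simp
        show "\<epsilon> - A r1 > 0" using \<open>A r1 < \<epsilon>\<close> by simp
        fix x assume "r1 < x" "x \<le> r" "\<epsilon> - A x = 0"
        then have "x \<ge> R" "x > 0" "A x \<ge> \<epsilon>" using \<open>r1 \<ge> R\<close> \<open>R > 0\<close> by auto
        let ?d = "(1 + A x) * (1 - m * A x * (1 + (p x)\<^sup>2 * (c - 1 + c * A x))) / x"
        have "?d \<le> - 1 / x" by (rule bound) fact+
        also have "\<dots> < 0" using \<open>x > 0\<close> by simp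
        finally have "- ?d > 0" by linarith
        moreover have "((\<lambda>r. \<epsilon> - A r) has_real_derivative - ?d) (at x)"
          using DERIV_diff[OF DERIV_const A_deriv[OF \<open>x > 0\<close>], of \<epsilon>] by simp
        ultimately show "((\<lambda>r. \<epsilon> - A r) has_real_derivative - ?d) (at x) \<and> - ?d > 0"
          by blast
      qed
      then show ?thesis by simp
    qed
    then show ?thesis by (rule eventually_at_top_linorderI)
  qed
  show "(A \<longlongrightarrow> 0) at_top"
  proof (rule order_tendstoI)
    fix a :: real assume "a < 0"
    then show "\<forall>\<^sub>F r in at_top. a < A r"
      using A_pos by (intro eventually_mono[OF eventually_gt_at_top[of 0]]) force
  qed (rule A_small)
qed

section \<open>The limit for the initial value problem\<close>

theorem theorem1p2:
  fixes n :: nat and lam mu :: real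
    and f f_r f_rr :: "real \<Rightarrow> real"
  assumes "n \<ge> 2"
    and "lam > 1 / (real n - 1)"
    and "mu < 0"
    and "\<And>r. r \<ge> 0 \<Longrightarrow> (f has_real_derivative f_r r) (at r within {0..})"
    and "continuous_on {0..} f_r"
    and "\<And>r. r > 0 \<Longrightarrow> (f_r has_real_derivative f_rr r) (at r)"
    and "continuous_on {0<..} f_rr"
    and "\<And>r. r > 0 \<Longrightarrow> r * f_r r - f r \<noteq> 0"
    and "\<And>r. r > 0 \<Longrightarrow>
           f_rr r + (real n - 1) / r * (1 + (f_r r)\<^sup>2) * f_r r
             - 1 / lam * ((1 + (f_r r)\<^sup>2)\<^sup>2 / (r * f_r r - f r)) = 0"
    and "f 0 = mu"
    and "f_r 0 = 0"
  shows "((\<lambda>r. r * f_r r / f r) \<longlongrightarrow>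
           lam * (real n - 1) / (lam * (real n - 1) - 1)) at_top"
proof -
  define m where "m = real n - 1"
  define c where "c = lam * m"
  define w where "w r = r * f_r r - f r" for r
  define A where "A r = (1 + (f_r r)\<^sup>2) * r / (c * w r * f_r r) - 1" for r
  have "m > 0" using \<open>n \<ge> 2\<close> by (simp add: m_def)
  then have "c > 1"
    using \<open>lam > 1 / (real n - 1)\<close> by (simp add: c_def m_def field_simps)
  have "lam > 0" using \<open>c > 1\<close> \<open>m > 0\<close> zero_less_mult_pos2[of lam m] by (simp add: c_def)
  have contf: "continuous_on {0..} f"
    using assms(4) by (intro DERIV_continuous_on[where D = f_r]) auto
  have fd: "(f has_real_derivative f_r r) (at r)" if "r > 0" for r
    using assms(4)[of r] at_within_interior[of r "{0..}"] that by simp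
  have pd: "(f_r has_real_derivative f_rr r) (at r)" if "r > 0" for r
    using assms(6) that .
  have ode: "f_rr r = (1 + (f_r r)\<^sup>2) * ((1 + (f_r r)\<^sup>2) / (lam * w r) - m * f_r r / r)"
    if "r > 0" for r
  proof -
    have "f_rr r = 1 / lam * ((1 + (f_r r)\<^sup>2)\<^sup>2 / w r) - m / r * (1 + (f_r r)\<^sup>2) * f_r r"
      using assms(9)[OF that] unfolding w_def m_def by linarith
    also have "\<dots> = (1 + (f_r r)\<^sup>2) * ((1 + (f_r r)\<^sup>2) / (lam * w r) - m * f_r r / r)"
      unfolding power2_eq_square[of "1 + (f_r r)\<^sup>2"] right_diff_distrib by simp
    finally show ?thesis .
  qed
  have contw: "continuous_on {0..} w"
    unfolding w_def by (intro continuous_intros contf assms(5))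
  have w_pos: "w r > 0" if "r > 0" for r
  proof (rule stays_positive[where a = 0 and b = r and g = w])
    show "continuous_on {0..r} w"
      by (rule continuous_on_subset[OF contw]) auto
  qed (use that assms(3,8,10) in \<open>auto simp: w_def\<close>)
  have wd: "(w has_real_derivative r * f_rr r) (at r)" if "r > 0" for r
    unfolding w_def
    using that by (auto intro!: derivative_eq_intros fd pd)
  have contp: "continuous_on {a..b} f_r" if "a \<ge> 0" for a b
    by (rule continuous_on_subset[OF assms(5)]) (use that in auto)
  have p_pos: "f_r r > 0" if "r > 0" for r
  proof (rule ccontr)
    assume "\<not> f_r r > 0"
    have nonpos: "f_r s \<le> 0" if "0 < s" "s \<le> r" for s
    proof (rule ccontr)
      assume "\<not> f_r s \<le> 0"
      have "f_r r > 0"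
      proof (rule stays_positive[OF \<open>s \<le> r\<close>])
        show "continuous_on {s..r} f_r" using contp that by simp
        show "f_r s > 0" using \<open>\<not> f_r s \<le> 0\<close> by simp
        fix x assume "s < x" "x \<le> r" "f_r x = 0"
        then show "(f_r has_real_derivative f_rr x) (at x) \<and> f_rr x > 0"
          using pd[of x] ode[of x] w_pos[of x] \<open>0 < s\<close> \<open>lam > 0\<close> by simp
      qed
      then show False using \<open>\<not> f_r r > 0\<close> by simp
    qed
    \<comment> \<open>Where the slope is nonpositive, the equation makes it strictly increase, so it would
      have started below \<open>f_r r \<le> 0\<close>.\<close>
    have "f_r 0 < f_r r"
    proof (rule DERIV_pos_imp_increasing_open[OF \<open>r > 0\<close> _ contp])
      fix x assume "0 < x" "x < r"
      have "m * f_r x / x \<le> 0"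
        using nonpos[of x] \<open>0 < x\<close> \<open>x < r\<close> \<open>m > 0\<close>
        by (intro divide_nonpos_pos mult_nonneg_nonpos) auto
      moreover have "(1 + (f_r x)\<^sup>2) / (lam * w x) > 0"
        using w_pos[of x] \<open>0 < x\<close> \<open>lam > 0\<close> by (simp add: add_pos_nonneg)
      ultimately have "f_rr x > 0"
        unfolding ode[OF \<open>0 < x\<close>] by (intro mult_pos_pos) (auto simp: add_pos_nonneg)
      then show "\<exists>y. (f_r has_real_derivative y) (at x) \<and> y > 0"
        using pd \<open>0 < x\<close> by blast
    qed simp
    then show False using \<open>\<not> f_r r > 0\<close> assms(11) by simp
  qed
  have p_deriv: "f_rr r = m * (1 + (f_r r)\<^sup>2) * f_r r * A r / r" if "r > 0" for r
    using w_pos[OF that] p_pos[OF that] that \<open>lam > 0\<close> \<open>m > 0\<close>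
    unfolding ode[OF that] A_def c_def by (simp add: field_simps)
  have q_eq: "r * f_r r / w r = c * (1 + A r) * (f_r r)\<^sup>2 / (1 + (f_r r)\<^sup>2)" if "r > 0" for r
  proof -
    define S where "S = 1 + (f_r r)\<^sup>2"
    have "S > 0" by (simp add: S_def add_pos_nonneg)
    moreover have "1 + A r = S * r / (c * w r * f_r r)" by (simp add: A_def S_def)
    ultimately show ?thesis
      using w_pos[OF that] p_pos[OF that] \<open>c > 1\<close>
      unfolding S_def[symmetric] by (simp add: power2_eq_square)
  qed
  have A_deriv: "(A has_real_derivative
      (1 + A r) * (1 - m * A r * (1 + (f_r r)\<^sup>2 * (c - 1 + c * A r))) / r) (at r)"
    if "r > 0" for r
  proof -
    define p where "p = f_r r"
    have nz: "w r \<noteq> 0" "p > 0" "1 + p\<^sup>2 \<noteq> 0" "c \<noteq> 0" "r \<noteq> 0"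
      using w_pos[OF that] p_pos[OF that] that \<open>c > 1\<close> sum_squares_gt_zero_iff[of 1 p]
      by (auto simp: p_def power2_eq_square)
    have raw: "(A has_real_derivative
        (((2 * p * f_rr r) * r + (1 + p\<^sup>2)) * (c * w r * p)
          - (1 + p\<^sup>2) * r * (c * (r * f_rr r) * p + c * w r * f_rr r)) / (c * w r * p)\<^sup>2) (at r)"
      unfolding A_def p_def
      by (rule derivative_eq_intros pd[OF that] wd[OF that] refl)+
         (use nz in \<open>auto simp: p_def power2_eq_square algebra_simps\<close>)
    have "(((2 * p * f_rr r) * r + (1 + p\<^sup>2)) * (c * w r * p)
          - (1 + p\<^sup>2) * r * (c * (r * f_rr r) * p + c * w r * f_rr r)) / (c * w r * p)\<^sup>2
        = (1 + A r) * (2 * p * (r * f_rr r) / (1 + p\<^sup>2) + 1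
             - (r * p / w r) * (r * f_rr r) / p - (r * f_rr r) / p) / r"
      using nz unfolding A_def p_def[symmetric] by (simp add: divide_simps) algebra
    \<comment> \<open>The bracket is \<open>r\<close> times the logarithmic derivative of \<open>1 + A\<close>; eliminating \<open>f_rr\<close> and \<open>w\<close>
      closes the system.\<close>
    also have "2 * p * (r * f_rr r) / (1 + p\<^sup>2) + 1
             - (r * p / w r) * (r * f_rr r) / p - (r * f_rr r) / p
        = 1 - m * A r * (1 + p\<^sup>2 * (c - 1 + c * A r))"
      using nz unfolding q_eq[OF that, folded p_def] p_deriv[OF that, folded p_def]
      by (simp add: divide_simps) algebra
    finally show ?thesis using raw by (simp add: p_def)
  qed
  have A_pos: "A r > 0" if "r > 0" for r
  proof (rule ccontr)
    assume "\<not> A r > 0"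
    have nonpos: "A s \<le> 0" if "0 < s" "s \<le> r" for s
    proof (rule ccontr)
      assume "\<not> A s \<le> 0"
      have "A r > 0"
      proof (rule stays_positive[OF \<open>s \<le> r\<close>])
        show "continuous_on {s..r} A"
          using \<open>0 < s\<close>
          by (intro continuous_at_imp_continuous_on ballI DERIV_isCont[OF A_deriv]) auto
        show "A s > 0" using \<open>\<not> A s \<le> 0\<close> by simp
        fix x assume "s < x" "x \<le> r" "A x = 0"
        then show "(A has_real_derivative 1 / x) (at x) \<and> 1 / x > 0"
          using A_deriv[of x] \<open>0 < s\<close> by simp
      qed
      then show False using \<open>\<not> A r > 0\<close> by simp
    qed
    \<comment> \<open>The slope has the monotonicity given by the sign of \<open>A\<close>, so it would have decreased from
      \<open>0\<close>.\<close>
    have "f_r r \<le> f_r 0"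
    proof (rule DERIV_nonpos_imp_decreasing_open[OF _ _ contp])
      fix x assume "0 < x" "x < r"
      then have "f_rr x \<le> 0"
        unfolding p_deriv[OF \<open>0 < x\<close>]
        using nonpos[of x] p_pos[of x] \<open>m > 0\<close>
        by (intro divide_nonpos_pos mult_nonneg_nonpos) auto
      then show "\<exists>y. (f_r has_real_derivative y) (at x) \<and> y \<le> 0"
        using pd \<open>0 < x\<close> by blast
    qed (use that in auto)
    then show False using p_pos[OF that] assms(11) by simp
  qed
  have p_lim: "filterlim f_r at_top at_top" and A_lim: "(A \<longlongrightarrow> 0) at_top"
    using slope_system_limits[OF \<open>m > 0\<close> \<open>c > 1\<close> p_pos A_pos _ A_deriv] pd p_deriv by auto
  have "((\<lambda>r. 1 / (1 - (1 + (inverse (f_r r))\<^sup>2) / (c * (1 + A r))))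
          \<longlongrightarrow> 1 / (1 - (1 + 0\<^sup>2) / (c * (1 + 0)))) at_top"
    using \<open>c > 1\<close> tendsto_inverse_0_at_top[OF p_lim] A_lim by (intro tendsto_intros) auto
  also have "1 / (1 - (1 + 0\<^sup>2) / (c * (1 + 0))) = c / (c - 1)"
    using \<open>c > 1\<close> by (simp add: field_simps)
  finally show ?thesis
    unfolding c_def m_def
  proof (rule Lim_transform_eventually)
    show "\<forall>\<^sub>F r in at_top. 1 / (1 - (1 + (inverse (f_r r))\<^sup>2) / (lam * (real n - 1) * (1 + A r)))
            = r * f_r r / f r"
      using eventually_gt_at_top[of 0]
    proof eventually_elim
      case (elim r)
      have pos: "f_r r > 0" "w r > 0" "A r > 0"
        using p_pos A_pos w_pos elim by auto
      have "1 + (f_r r)\<^sup>2 \<noteq> 0" using zero_le_power2[of "f_r r"] by linarith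
      then have "(1 + (inverse (f_r r))\<^sup>2) / (c * (1 + A r)) = inverse (r * f_r r / w r)"
        unfolding q_eq[OF elim] using pos \<open>c > 1\<close> by (simp add: divide_simps)
      also have "\<dots> = 1 - f r / (r * f_r r)"
        using pos elim by (simp add: w_def field_simps)
      finally show ?case by (simp add: c_def m_def)
    qed
  qed
qed

end
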